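(* Let $(\mathfrak{s}_\sigma,\mathfrak{q}_\Phi)$ be the CR algebra of a real orbit $M_{\Phi,\sigma}$ of a real form $\mathbf{S}_\sigma$ in the complex flag manifold $F_\Phi=\mathbf{S}/\mathbf{Q}_\Phi$ of a connected, simply connected complex semisimple Lie group $\mathbf{S}$. If $M_{\Phi,\sigma}$ is of the minimal type, then $M_{\Phi,\sigma}$ either is holomorphically degenerate or has Levi order less than or equal to $2$.
   Context: Let $\mathfrak{s}$ be the complex semisimple Lie algebra of $\mathbf{S}$, $\sigma$ an anti-$\mathbb{C}$-linear involution of $\mathfrak{s}$, $\mathfrak{s}_\sigma$ its real form of fixed points, $\mathbf{S}_\sigma\subset\mathbf{S}$ the corresponding real form of the group. Let $\mathfrak{h}$ be a $\sigma$-invariant Cartan subalgebra of $\mathfrak{s}$, $\mathcal{R}$ the root system of $(\mathfrak{s},\mathfrak{h})$, $\mathfrak{s}^\beta$ the root space of $\beta$, and let $\bar\beta=\sigma(\beta)$ denote the root with $\sigma(\mathfrak{s}^\beta)=\mathfrak{s}^{\bar\beta}$. Put $\mathcal{R}_\bullet=\{\beta\in\mathcal{R}\mid\bar\beta=-\beta\}$; these are the roots fixed by the map $\beta\mapsto-\bar\beta$ induced by a Cartan involution of $\mathfrak{s}$ commuting with $\sigma$ and preserving $\mathfrak{h}$. Let $\mathcal{B}$ be a basis of simple roots of $\mathcal{R}$, write $\beta=\sum_{\alpha\in\mathcal{B}}k_{\beta,\alpha}\alpha$, let $\Phi\subseteq\mathcal{B}$ and $\xi_\Phi(\beta)=\sum_{\alpha\in\Phi}k_{\beta,\alpha}$.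 Set $\mathcal{Q}_\Phi=\{\beta\in\mathcal{R}\mid\xi_\Phi(\beta)\le 0\}$, $\mathcal{Q}_\Phi^{n}=\{\beta\mid\xi_\Phi(\beta)<0\}$, $\mathcal{Q}_\Phi^{c}=\{\beta\mid\xi_\Phi(\beta)>0\}$, and $\mathfrak{q}_\Phi=\mathfrak{h}\oplus\sum_{\beta\in\mathcal{Q}_\Phi}\mathfrak{s}^\beta$, the Lie algebra of the parabolic subgroup $\mathbf{Q}_\Phi$. A bar over a set of roots or a subspace of $\mathfrak{s}$ denotes its image under $\sigma$. $M_{\Phi,\sigma}$ is the $\mathbf{S}_\sigma$-orbit of the base point of $F_\Phi$, with the CR structure induced by $F_\Phi$ and CR algebra $(\mathfrak{s}_\sigma,\mathfrak{q}_\Phi)$; its Levi order is that of the CR algebra. $M_{\Phi,\sigma}$ (and $(\mathfrak{s}_\sigma,\mathfrak{q}_\Phi)$) is of the minimal type if $\mathcal{Q}_\Phi^{c}\cap\bar{\mathcal{Q}}_\Phi^{n}\subseteq\mathcal{R}_\bullet$. Levi chain: for $\mathfrak{q}=\mathfrak{q}_\Phi$, $\mathfrak{q}^{(0)}=\mathfrak{q}$ and $\mathfrak{q}^{(p)}=\{Z\in\mathfrak{q}^{(p-1)}\mid[Z,\bar{\mathfrak{q}}]\subseteq\mathfrak{q}^{(p-1)}+\bar{\mathfrak{q}}\}$ for $p\ge1$. The Levi order is the positive integer $q$ with $\mathfrak{q}^{(q-1)}\supsetneq\mathfrak{q}^{(q)}=\mathfrak{q}\cap\bar{\mathfrak{q}}$,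 if it exists. $(\mathfrak{s}_\sigma,\mathfrak{q})$ is holomorphically degenerate if $\mathfrak{q}^{(p)}\ne\mathfrak{q}\cap\bar{\mathfrak{q}}$ for all integers $p>0$. "Levi order less than or equal to $2$" means $\mathfrak{q}^{(2)}=\mathfrak{q}\cap\bar{\mathfrak{q}}$ (so the trivial case $\mathfrak{q}=\bar{\mathfrak{q}}$ is counted as Levi order $0$). *)

theory Defs
  imports Complex_Main "HOL-Library.Set_Algebras"
begin

locale complex_lie_algebra = vector_space scale
  for scale :: "complex \<Rightarrow> 's::ab_group_add \<Rightarrow> 's" (infixr \<open>*s\<close> 75) +
  fixes br :: "'s \<Rightarrow> 's \<Rightarrow> 's"
  assumes br_add_left: "br (x + y) z = br x z + br y z"
    and br_add_right: "br x (y + z) = br x y + br x z"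
    and br_scale_left: "br (c *s x) y = c *s br x y"
    and br_scale_right: "br x (c *s y) = c *s br x y"
    and br_self: "br x x = 0"
    and jacobi: "br x (br y z) + br y (br z x) + br z (br x y) = 0"
begin

definition lie_ideal :: "'s set \<Rightarrow> bool" where
  "lie_ideal I \<longleftrightarrow> subspace I \<and> (\<forall>x. \<forall>y\<in>I. br x y \<in> I)"

primrec derived_series :: "'s set \<Rightarrow> nat \<Rightarrow> 's set" where
  "derived_series I 0 = I"
| "derived_series I (Suc n) =
     span {br x y | x y. x \<in> derived_series I n \<and> y \<in> derived_series I n}"

definition solvable :: "'s set \<Rightarrow> bool" where
  "solvable I \<longleftrightarrow> (\<exists>n. derived_series I n = {0})"

definition semisimple :: bool where
  "semisimple \<longleftrightarrow> (\<forall>I. lie_ideal I \<and> solvable I \<longrightarrow> I = {0})"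

text \<open>Over the complex numbers, a semisimple endomorphism is a diagonalizable one.\<close>

definition ad_semisimple :: "'s \<Rightarrow> bool" where
  "ad_semisimple h \<longleftrightarrow> span {x. \<exists>c. br h x = c *s x} = UNIV"

definition abelian :: "'s set \<Rightarrow> bool" where
  "abelian K \<longleftrightarrow> subspace K \<and> (\<forall>x\<in>K. \<forall>y\<in>K. br x y = 0)"

text \<open>Cartan subalgebras of a complex semisimple Lie algebra, as in Helgason's
  Differential Geometry, Lie Groups, and Symmetric Spaces, Ch. III.\<close>

definition cartan_subalgebra :: "'s set \<Rightarrow> bool" where
  "cartan_subalgebra H \<longleftrightarrow>
     abelian H \<and> (\<forall>K. abelian K \<and> H \<subseteq> K \<longrightarrow> K = H) \<and> (\<forall>h\<in>H. ad_semisimple h)"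

text \<open>A linear form on \<open>H\<close> is represented by the function that extends it by zero
  outside \<open>H\<close>, so that equality of forms is equality of functions.  In particular
  \<open>- \<beta>\<close> and linear combinations of forms are formed pointwise.\<close>

definition dual_space :: "'s set \<Rightarrow> ('s \<Rightarrow> complex) set" where
  "dual_space H = {\<beta>. (\<forall>x\<in>H. \<forall>y\<in>H. \<beta> (x + y) = \<beta> x + \<beta> y) \<and>
                      (\<forall>c. \<forall>x\<in>H. \<beta> (c *s x) = c * \<beta> x) \<and> (\<forall>x. x \<notin> H \<longrightarrow> \<beta> x = 0)}"

definition root_space :: "'s set \<Rightarrow> ('s \<Rightarrow> complex) \<Rightarrow> 's set" where
  "root_space H \<beta> = {x. \<forall>h\<in>H. br h x = \<beta> h *s x}"

definition roots :: "'s set \<Rightarrow> ('s \<Rightarrow> complex) set" where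
  "roots H = {\<beta> \<in> dual_space H. \<beta> \<noteq> (\<lambda>_. 0) \<and> root_space H \<beta> \<noteq> {0}}"

definition simple_basis :: "'s set \<Rightarrow> ('s \<Rightarrow> complex) set \<Rightarrow> bool" where
  "simple_basis H B \<longleftrightarrow> finite B \<and> B \<subseteq> roots H \<and>
     (\<forall>c :: ('s \<Rightarrow> complex) \<Rightarrow> real.
        (\<forall>x. (\<Sum>\<alpha>\<in>B. of_real (c \<alpha>) * \<alpha> x) = 0) \<longrightarrow> (\<forall>\<alpha>\<in>B. c \<alpha> = 0)) \<and>
     (\<forall>\<beta>\<in>roots H. \<exists>k :: ('s \<Rightarrow> complex) \<Rightarrow> int.
        ((\<forall>\<alpha>\<in>B. 0 \<le> k \<alpha>) \<or> (\<forall>\<alpha>\<in>B. k \<alpha> \<le> 0)) \<and>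
        \<beta> = (\<lambda>x. \<Sum>\<alpha>\<in>B. of_int (k \<alpha>) * \<alpha> x))"

text \<open>An anti-linear involution encodes the real form of its fixed points.\<close>

definition antilinear_involution :: "('s \<Rightarrow> 's) \<Rightarrow> bool" where
  "antilinear_involution \<sigma> \<longleftrightarrow>
     (\<forall>x y. \<sigma> (x + y) = \<sigma> x + \<sigma> y) \<and> (\<forall>c x. \<sigma> (c *s x) = cnj c *s \<sigma> x) \<and>
     (\<forall>x y. \<sigma> (br x y) = br (\<sigma> x) (\<sigma> y)) \<and> (\<forall>x. \<sigma> (\<sigma> x) = x)"

definition conj_root :: "'s set \<Rightarrow> ('s \<Rightarrow> 's) \<Rightarrow> ('s \<Rightarrow> complex) \<Rightarrow> ('s \<Rightarrow> complex)" where
  "conj_root H \<sigma> \<beta> = (THE \<gamma>. \<gamma> \<in> roots H \<and> \<sigma> ` root_space H \<beta> = root_space H \<gamma>)"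

text \<open>The roots \<open>\<R>\<^sub>\<bullet>\<close>.\<close>

definition imaginary_roots :: "'s set \<Rightarrow> ('s \<Rightarrow> 's) \<Rightarrow> ('s \<Rightarrow> complex) set" where
  "imaginary_roots H \<sigma> = {\<beta> \<in> roots H. conj_root H \<sigma> \<beta> = - \<beta>}"

text \<open>The requirement outside \<open>B\<close> only makes the coefficient function unique.\<close>

definition root_coeff :: "('s \<Rightarrow> complex) set \<Rightarrow> ('s \<Rightarrow> complex) \<Rightarrow> ('s \<Rightarrow> complex) \<Rightarrow> int" where
  "root_coeff B \<beta> = (THE k. (\<forall>\<alpha>. \<alpha> \<notin> B \<longrightarrow> k \<alpha> = 0) \<and>
                            \<beta> = (\<lambda>x. \<Sum>\<alpha>\<in>B. of_int (k \<alpha>) * \<alpha> x))"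

definition xi :: "('s \<Rightarrow> complex) set \<Rightarrow> ('s \<Rightarrow> complex) set \<Rightarrow> ('s \<Rightarrow> complex) \<Rightarrow> int" where
  "xi B \<Phi> \<beta> = (\<Sum>\<alpha>\<in>\<Phi>. root_coeff B \<beta> \<alpha>)"

definition Q_set :: "'s set \<Rightarrow> ('s \<Rightarrow> complex) set \<Rightarrow> ('s \<Rightarrow> complex) set \<Rightarrow> ('s \<Rightarrow> complex) set" where
  "Q_set H B \<Phi> = {\<beta> \<in> roots H. xi B \<Phi> \<beta> \<le> 0}"

definition Qn_set :: "'s set \<Rightarrow> ('s \<Rightarrow> complex) set \<Rightarrow> ('s \<Rightarrow> complex) set \<Rightarrow> ('s \<Rightarrow> complex) set" where
  "Qn_set H B \<Phi> = {\<beta> \<in> roots H. xi B \<Phi> \<beta> < 0}"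

definition Qc_set :: "'s set \<Rightarrow> ('s \<Rightarrow> complex) set \<Rightarrow> ('s \<Rightarrow> complex) set \<Rightarrow> ('s \<Rightarrow> complex) set" where
  "Qc_set H B \<Phi> = {\<beta> \<in> roots H. xi B \<Phi> \<beta> > 0}"

definition parabolic :: "'s set \<Rightarrow> ('s \<Rightarrow> complex) set \<Rightarrow> ('s \<Rightarrow> complex) set \<Rightarrow> 's set" where
  "parabolic H B \<Phi> = span (H \<union> (\<Union>\<beta>\<in>Q_set H B \<Phi>. root_space H \<beta>))"

definition minimal_type ::
  "'s set \<Rightarrow> ('s \<Rightarrow> 's) \<Rightarrow> ('s \<Rightarrow> complex) set \<Rightarrow> ('s \<Rightarrow> complex) set \<Rightarrow> bool" where
  "minimal_type H \<sigma> B \<Phi> \<longleftrightarrow>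
     Qc_set H B \<Phi> \<inter> conj_root H \<sigma> ` Qn_set H B \<Phi> \<subseteq> imaginary_roots H \<sigma>"

primrec levi_chain :: "('s \<Rightarrow> 's) \<Rightarrow> 's set \<Rightarrow> nat \<Rightarrow> 's set" where
  "levi_chain \<sigma> \<qq> 0 = \<qq>"
| "levi_chain \<sigma> \<qq> (Suc p) =
     {Z \<in> levi_chain \<sigma> \<qq> p. \<forall>W \<in> \<sigma> ` \<qq>. br Z W \<in> levi_chain \<sigma> \<qq> p + \<sigma> ` \<qq>}"

text \<open>For a subalgebra \<open>\<qq>\<close> the chain is decreasing, contains \<open>\<qq> \<inter> \<sigma> ` \<qq>\<close> and is
  constant once two consecutive terms agree.  Hence its term of index \<open>n\<close> is
  \<open>\<qq> \<inter> \<sigma> ` \<qq>\<close> iff the Levi order exists and is at most \<open>n\<close>, where the case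
  \<open>\<qq> = \<sigma> ` \<qq>\<close> counts as order \<open>0\<close>.\<close>

definition levi_order_le :: "('s \<Rightarrow> 's) \<Rightarrow> 's set \<Rightarrow> nat \<Rightarrow> bool" where
  "levi_order_le \<sigma> \<qq> n \<longleftrightarrow> levi_chain \<sigma> \<qq> n = \<qq> \<inter> \<sigma> ` \<qq>"

definition holomorphically_degenerate :: "('s \<Rightarrow> 's) \<Rightarrow> 's set \<Rightarrow> bool" where
  "holomorphically_degenerate \<sigma> \<qq> \<longleftrightarrow> (\<forall>p>0. levi_chain \<sigma> \<qq> p \<noteq> \<qq> \<inter> \<sigma> ` \<qq>)"

end

locale complex_semisimple_lie_algebra = complex_lie_algebra +
  assumes finite_dimensional: "\<exists>S. finite S \<and> span S = UNIV"
    and semisimple: semisimple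

end

theory Submission
  imports Defs "HOL-Library.Function_Algebras"
begin

text \<open>
  Write \<open>\<qq>\<close> for the parabolic subalgebra, \<open>\<rr> = \<sigma> ` \<qq>\<close> for its conjugate and \<open>\<SS> = \<qq> + \<rr>\<close>.
  The claim follows from the stronger fact that, for the minimal type, the Levi chain is
  stationary from index \<open>2\<close> on: its second and third terms agree (\<open>levi_chain_3_eq_2\<close>).
  Then either no term equals \<open>\<qq> \<inter> \<rr>\<close>, or the second one does.

  Unwinding the recursion, \<open>Z \<in> \<qq>\<close> lies in the \<open>n\<close>-th term iff every iterated bracket
  \<open>[\<dots>[Z, W\<^sub>1], \<dots>, W\<^sub>k]\<close> with \<open>k \<le> n\<close> and \<open>W\<^sub>i \<in> \<rr>\<close> lies in \<open>\<SS>\<close> (\<open>levi_chain_iff\<close>).  So let \<open>Z\<close> be in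
  the second term and suppose that some threefold bracket \<open>T = [[[Z, W\<^sub>1], W\<^sub>2], W\<^sub>3]\<close> is not
  in \<open>\<SS>\<close>.  All terms of the chain are stable under the Cartan subalgebra, hence sums of their
  weight components, and we may take \<open>Z\<close> and the \<open>W\<^sub>i\<close> to be weight vectors, of weights \<open>\<beta>\<close>
  and \<open>\<alpha>\<^sub>i\<close>.

  Exchanging two of the \<open>W\<^sub>i\<close> changes \<open>T\<close> by a twofold bracket of \<open>Z\<close> with elements of \<open>\<rr>\<close>,
  which is in \<open>\<SS>\<close> (\<open>triple_swap\<close>).  So the order of the \<open>W\<^sub>i\<close> is irrelevant.  None of them lies in
  \<open>\<qq>\<close>, since bracketing with \<open>\<qq> \<inter> \<rr>\<close> as the last step preserves \<open>\<SS>\<close>; hence \<open>\<xi>(\<alpha>\<^sub>i) > 0\<close>.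
  The vectors \<open>Z\<close>, \<open>[Z, W\<^sub>1]\<close> and \<open>[[Z, W\<^sub>1], W\<^sub>2]\<close> lie in \<open>\<SS>\<close> but not in \<open>\<rr>\<close>, so \<open>\<beta>\<close>,
  \<open>\<beta> + \<alpha>\<^sub>1\<close> and \<open>\<beta> + \<alpha>\<^sub>1 + \<alpha>\<^sub>2\<close> are weights of \<open>\<qq>\<close> and not of \<open>\<rr>\<close>.  As \<open>\<xi>\<close> is at most \<open>0\<close> on the
  last of these and increases strictly, it is negative on the first two, and there the minimal
  type forces \<open>\<beta>\<close> and \<open>\<beta> + \<alpha>\<^sub>1\<close>, hence also \<open>\<alpha>\<^sub>1\<close>, to be imaginary: conjugation acts as \<open>-1\<close>
  (\<open>imaginary_step\<close>).  By symmetry all \<open>\<alpha>\<^sub>i\<close> are imaginary, and so is the weight \<open>\<omega>\<close> of \<open>T\<close>.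
  But \<open>T \<notin> \<SS>\<close> requires both \<open>\<xi>(\<omega>)\<close> and \<open>\<xi>(- \<omega>)\<close> to be positive, which is absurd
  (\<open>triple_weight_vectors\<close>).
\<close>

section \<open>Brackets and the Levi chain\<close>

context complex_lie_algebra
begin

lemma br_zero_left [simp]: "br 0 x = 0"
  using br_add_left[of 0 0 x] by simp

lemma br_zero_right [simp]: "br x 0 = 0"
  using br_add_right[of x 0 0] by simp

lemma br_antisym: "br x y = - br y x"
proof -
  have "br (x + y) (x + y) = br x y + br y x"
    by (simp only: br_add_left br_add_right br_self[of x] br_self[of y] add_0_left add_0_right
        add.commute)
  then have "br x y + br y x = 0"
    by (metis br_self)
  then show ?thesis
    by (simp only: eq_neg_iff_add_eq_0)
qed

lemma br_minus_right: "br x (- y) = - br x y"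
  using br_add_right[of x "- y" y] by (simp add: eq_neg_iff_add_eq_0)

lemma br_sum_right: "br x (sum f F) = (\<Sum>i\<in>F. br x (f i))"
  by (induction F rule: infinite_finite_induct) (simp_all add: br_add_right)

text \<open>The Jacobi identity, in the two forms needed: \<open>br x\<close> is a derivation, and the last two
  arguments of an iterated bracket commute up to a bracket with their own bracket.\<close>

lemma br_derivation: "br x (br y z) = br (br x y) z + br y (br x z)"
proof -
  have "br (br x y) z = - br z (br x y)" "br y (br x z) = - br y (br z x)"
    using br_antisym[of "br x y" z] br_antisym[of x z] by (simp_all add: br_minus_right)
  moreover have "br x (br y z) = - (br y (br z x) + br z (br x y))"
    using jacobi[of x y z] by (simp only: eq_neg_iff_add_eq_0 add.assoc)
  ultimately show ?thesis
    by (simp only: minus_add)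
qed

lemma br_br_swap: "br (br x y) z = br (br x z) y + br x (br y z)"
  by (subst br_derivation[of x y z], subst br_antisym[of y "br x z"]) simp

lemma subspace_ball_br:
  assumes "subspace V" shows "subspace {x. \<forall>w\<in>R. br x w \<in> V}"
  using assms by (auto simp: subspace_def br_add_left br_scale_left)

lemma subspace_br_right:
  assumes "subspace V" shows "subspace {w. br x w \<in> V}"
  using assms by (auto simp: subspace_def br_add_right br_scale_right)

lemma subspace_set_plus:
  assumes "subspace V" "subspace W" shows "subspace (V + W)"
proof -
  have "V + W = {x + y |x y. x \<in> V \<and> y \<in> W}" by (auto simp: set_plus_def)
  then show ?thesis using subspace_sums[OF assms] by simp
qed

lemma subset_set_plus:
  assumes "subspace V" "subspace W" shows "V \<subseteq> V + W" "W \<subseteq> V + W"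
proof -
  show "V \<subseteq> V + W" using set_plus_intro[OF _ subspace_0[OF assms(2)]] by fastforce
  show "W \<subseteq> V + W" using set_plus_intro[OF subspace_0[OF assms(1)]] by fastforce
qed

lemma foldl_br_add: "foldl br (x + y) ws = foldl br x ws + foldl br y ws"
  by (induction ws arbitrary: x y) (simp_all add: br_add_left)

definition br_closed :: "'s set \<Rightarrow> bool" where
  "br_closed R \<longleftrightarrow> (\<forall>x\<in>R. \<forall>y\<in>R. br x y \<in> R)"

lemma br_closedD: "br_closed R \<Longrightarrow> x \<in> R \<Longrightarrow> y \<in> R \<Longrightarrow> br x y \<in> R"
  by (simp add: br_closed_def)

lemma foldl_br_closed:
  assumes "br_closed R" "x \<in> R" "set ws \<subseteq> R"
  shows "foldl br x ws \<in> R"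
  using assms(2,3) by (induction ws arbitrary: x) (auto intro: br_closedD[OF assms(1)])

text \<open>An element of \<open>\<rr> = \<sigma> ` \<qq>\<close> only has iterated brackets in \<open>\<rr>\<close>.  So the summand in \<open>\<rr>\<close> that the
  recursion allows to be split off at each step cannot influence whether later brackets lie
  in \<open>\<qq> + \<rr>\<close>, and the nested condition becomes one on iterated brackets of \<open>Z\<close> itself.\<close>

lemma levi_chain_iff:
  assumes q: "subspace \<qq>" and r: "subspace (\<sigma> ` \<qq>)"
    and cl: "br_closed (\<sigma> ` \<qq>)"
  shows "Z \<in> levi_chain \<sigma> \<qq> n \<longleftrightarrow>
    Z \<in> \<qq> \<and> (\<forall>ws. set ws \<subseteq> \<sigma> ` \<qq> \<and> length ws \<le> n \<longrightarrow> foldl br Z ws \<in> \<qq> + \<sigma> ` \<qq>)"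
proof (induction n arbitrary: Z)
  case 0
  show ?case using subset_set_plus(1)[OF q r] by auto
next
  case (Suc n)
  let ?R = "\<sigma> ` \<qq>"
  note S = subspace_set_plus[OF q r] and sub = subset_set_plus[OF q r]
  have *: "X \<in> levi_chain \<sigma> \<qq> n + ?R \<longleftrightarrow>
      (\<forall>ws. set ws \<subseteq> ?R \<and> length ws \<le> n \<longrightarrow> foldl br X ws \<in> \<qq> + ?R)" (is "_ \<longleftrightarrow> ?it X") for X
  proof
    assume "X \<in> levi_chain \<sigma> \<qq> n + ?R"
    then obtain a b where X: "X = a + b" "a \<in> levi_chain \<sigma> \<qq> n" "b \<in> ?R"
      by (auto elim: set_plus_elim)
    show "?it X"
    proof (intro allI impI)
      fix ws assume ws: "set ws \<subseteq> ?R \<and> length ws \<le> n"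
      have "foldl br a ws \<in> \<qq> + ?R" using X(2) ws Suc.IH by blast
      moreover have "foldl br b ws \<in> ?R" using foldl_br_closed[OF cl] X(3) ws by blast
      ultimately show "foldl br X ws \<in> \<qq> + ?R"
        unfolding X(1) foldl_br_add using subspace_add[OF S] sub(2) by blast
    qed
  next
    assume it: "?it X"
    from it[rule_format, of "[]"] obtain a b where X: "X = a + b" "a \<in> \<qq>" "b \<in> ?R"
      by (auto elim: set_plus_elim)
    have "foldl br a ws \<in> \<qq> + ?R" if ws: "set ws \<subseteq> ?R \<and> length ws \<le> n" for ws
    proof -
      have "foldl br X ws \<in> \<qq> + ?R" using it ws by blast
      moreover have "foldl br b ws \<in> \<qq> + ?R"
        using foldl_br_closed[OF cl] X(3) ws sub(2) by blast
      moreover have "foldl br a ws = foldl br X ws - foldl br b ws"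
        unfolding X(1) foldl_br_add by simp
      ultimately show ?thesis using subspace_diff[OF S] by simp
    qed
    then have "a \<in> levi_chain \<sigma> \<qq> n" using X(2) Suc.IH by blast
    then show "X \<in> levi_chain \<sigma> \<qq> n + ?R" using X by auto
  qed
  show ?case
  proof
    assume "Z \<in> levi_chain \<sigma> \<qq> (Suc n)"
    then have Z: "Z \<in> levi_chain \<sigma> \<qq> n" "\<forall>W\<in>?R. ?it (br Z W)"
      unfolding *[symmetric] by auto
    have "foldl br Z ws \<in> \<qq> + ?R" if "set ws \<subseteq> ?R \<and> length ws \<le> Suc n" for ws
      using that Z Suc.IH sub by (cases ws) auto
    then show "Z \<in> \<qq> \<and> (\<forall>ws. set ws \<subseteq> ?R \<and> length ws \<le> Suc n \<longrightarrow> foldl br Z ws \<in> \<qq> + ?R)"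
      using Z(1) Suc.IH by blast
  next
    assume Z: "Z \<in> \<qq> \<and> (\<forall>ws. set ws \<subseteq> ?R \<and> length ws \<le> Suc n \<longrightarrow> foldl br Z ws \<in> \<qq> + ?R)"
    then have "Z \<in> levi_chain \<sigma> \<qq> n" using Suc.IH by auto
    moreover have "?it (br Z W)" if "W \<in> ?R" for W
      using Z[THEN conjunct2, rule_format, of "W # ws" for ws] that by auto
    ultimately show "Z \<in> levi_chain \<sigma> \<qq> (Suc n)" by (simp add: *)
  qed
qed

lemma subspace_levi_chain:
  assumes "subspace \<qq>" "subspace (\<sigma> ` \<qq>)"
  shows "subspace (levi_chain \<sigma> \<qq> n)"
proof (induction n)
  case (Suc n)
  have "levi_chain \<sigma> \<qq> (Suc n)
      = levi_chain \<sigma> \<qq> n \<inter> {Z. \<forall>W\<in>\<sigma> ` \<qq>. br Z W \<in> levi_chain \<sigma> \<qq> n + \<sigma> ` \<qq>}"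
    by auto
  then show ?case
    using subspace_inter[OF Suc subspace_ball_br[OF subspace_set_plus[OF Suc assms(2)]]] by (simp only:)
qed (use assms in simp)

text \<open>The derivation property moves \<open>h\<close> past a bracket with \<open>W\<close>.  With \<open>h\<close> in the Cartan subalgebra
  this makes every term of the chain a sum of weight spaces intersected with it.\<close>

lemma levi_chain_ad_stable:
  assumes q: "br_closed \<qq>"
    and r: "br_closed (\<sigma> ` \<qq>)"
    and h: "h \<in> \<qq>" "h \<in> \<sigma> ` \<qq>" and sub: "subspace \<qq>" "subspace (\<sigma> ` \<qq>)"
    and Z: "Z \<in> levi_chain \<sigma> \<qq> n"
  shows "br h Z \<in> levi_chain \<sigma> \<qq> n"
  using Z
proof (induction n arbitrary: Z)
  case 0
  then show ?case using br_closedD[OF q] h by simp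
next
  case (Suc n)
  note S = subspace_set_plus[OF subspace_levi_chain[OF sub, of n] sub(2)]
  have st: "br h X \<in> levi_chain \<sigma> \<qq> n + \<sigma> ` \<qq>" if X: "X \<in> levi_chain \<sigma> \<qq> n + \<sigma> ` \<qq>" for X
  proof -
    obtain a b where X: "X = a + b" "a \<in> levi_chain \<sigma> \<qq> n" "b \<in> \<sigma> ` \<qq>"
      using set_plus_elim[OF X] by blast
    show ?thesis
      unfolding X(1) br_add_right
      by (intro set_plus_intro Suc.IH X(2) br_closedD[OF r] h(2) X(3))
  qed
  have "br (br h Z) W \<in> levi_chain \<sigma> \<qq> n + \<sigma> ` \<qq>" if W: "W \<in> \<sigma> ` \<qq>" for W
  proof -
    have "br (br h Z) W = br h (br Z W) - br Z (br h W)"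
      using br_derivation[of h Z W] by simp
    moreover have "br h (br Z W) \<in> levi_chain \<sigma> \<qq> n + \<sigma> ` \<qq>"
      using Suc.prems W by (intro st) auto
    moreover have "br Z (br h W) \<in> levi_chain \<sigma> \<qq> n + \<sigma> ` \<qq>"
      using Suc.prems br_closedD[OF r h(2) W] unfolding levi_chain.simps by blast
    ultimately show ?thesis using subspace_diff[OF S] by simp
  qed
  moreover have "br h Z \<in> levi_chain \<sigma> \<qq> n"
    using Suc by auto
  ultimately show ?case
    unfolding levi_chain.simps by blast
qed

lemma levi_chain_antimono: "m \<le> n \<Longrightarrow> levi_chain \<sigma> \<qq> n \<subseteq> levi_chain \<sigma> \<qq> m"
proof (induction n rule: dec_induct)
  case (step n)
  have "levi_chain \<sigma> \<qq> (Suc n) \<subseteq> levi_chain \<sigma> \<qq> n" by auto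
  with step.IH show ?case by blast
qed (rule subset_refl)

lemma levi_chain_stationary:
  assumes "levi_chain \<sigma> \<qq> (Suc m) = levi_chain \<sigma> \<qq> m" "m \<le> n"
  shows "levi_chain \<sigma> \<qq> n = levi_chain \<sigma> \<qq> m"
  using assms(2)
proof (induction n rule: dec_induct)
  case (step n)
  have "levi_chain \<sigma> \<qq> (Suc n) = levi_chain \<sigma> \<qq> (Suc m)"
    by (simp only: levi_chain.simps step.IH)
  then show ?case using assms(1) by (rule trans)
qed (rule refl)

lemma Int_subset_levi_chain:
  assumes "subspace \<qq>" "subspace (\<sigma> ` \<qq>)"
    and "br_closed (\<sigma> ` \<qq>)"
  shows "\<qq> \<inter> \<sigma> ` \<qq> \<subseteq> levi_chain \<sigma> \<qq> n"
proof
  fix Z assume Z: "Z \<in> \<qq> \<inter> \<sigma> ` \<qq>"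
  have "foldl br Z ws \<in> \<qq> + \<sigma> ` \<qq>" if "set ws \<subseteq> \<sigma> ` \<qq>" for ws
    using foldl_br_closed[OF assms(3) _ that] Z subset_set_plus(2)[OF assms(1,2)]
    by auto
  then show "Z \<in> levi_chain \<sigma> \<qq> n"
    unfolding levi_chain_iff[OF assms] using Z by blast
qed

section \<open>Weights of a Cartan subalgebra\<close>

lemma subspace_root_space: "subspace (root_space H \<alpha>)"
  by (auto simp: subspace_def root_space_def br_add_right br_scale_right scale_right_distrib
      scale_left_commute)

lemma br_root_space:
  assumes "x \<in> root_space H \<alpha>" "y \<in> root_space H \<beta>"
  shows "br x y \<in> root_space H (\<alpha> + \<beta>)"
  unfolding root_space_def
proof (intro CollectI ballI)
  fix h assume "h \<in> H"
  then have "br h x = \<alpha> h *s x" "br h y = \<beta> h *s y"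
    using assms by (auto simp: root_space_def)
  then show "br h (br x y) = (\<alpha> + \<beta>) h *s br x y"
    by (simp only: br_derivation[of h x y] br_scale_left br_scale_right plus_fun_apply
        scale_left_distrib)
qed

lemma dual_space_add: "\<alpha> \<in> dual_space H \<Longrightarrow> \<beta> \<in> dual_space H \<Longrightarrow> \<alpha> + \<beta> \<in> dual_space H"
  by (auto simp: dual_space_def algebra_simps)

lemma dual_space_zero: "0 \<in> dual_space H"
  by (auto simp: dual_space_def)

lemma rootsI:
  "\<alpha> \<in> dual_space H \<Longrightarrow> x \<in> root_space H \<alpha> \<Longrightarrow> x \<noteq> 0 \<Longrightarrow> \<alpha> \<noteq> 0 \<Longrightarrow> \<alpha> \<in> roots H"
  by (auto simp: roots_def zero_fun_def)

text \<open>A vector that commutes with \<open>H\<close> spans with \<open>H\<close> an abelian subalgebra, so it is in \<open>H\<close> by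
  maximality.  Hence \<open>H\<close> can be treated as the weight space of the weight \<open>0\<close>.\<close>

lemma root_space_cartan_0:
  assumes "cartan_subalgebra H"
  shows "root_space H 0 = H"
proof
  have ab: "abelian H" and mx: "\<And>K. abelian K \<Longrightarrow> H \<subseteq> K \<Longrightarrow> K = H"
    using assms by (auto simp: cartan_subalgebra_def)
  show "H \<subseteq> root_space H 0"
    using ab by (auto simp: abelian_def root_space_def)
  show "root_space H 0 \<subseteq> H"
  proof
    fix x assume "x \<in> root_space H 0"
    then have x: "br h x = 0" if "h \<in> H" for h
      using that by (auto simp: root_space_def)
    have gen: "br y z = 0" if "y \<in> insert x H" "z \<in> insert x H" for y z
      using that x ab br_antisym[of x] by (auto simp: abelian_def br_self)
    have s0: "subspace {0}" by (simp add: subspace_def)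
    have "br y z = 0" if y: "y \<in> span (insert x H)" and z: "z \<in> span (insert x H)" for y z
    proof -
      have 1: "br y z = 0" if "y \<in> insert x H" for y
        using z
      proof (rule span_induct)
        show "subspace {z. br y z = 0}" using subspace_br_right[OF s0, of y] by simp
      qed (rule gen[OF that])
      have 2: "subspace {y. br y z = 0}"
        using subspace_ball_br[OF s0, of "{z}"] by simp
      from y show ?thesis by (rule span_induct) (rule 2, rule 1)
    qed
    then have "abelian (span (insert x H))" by (simp add: abelian_def subspace_span)
    moreover have "H \<subseteq> span (insert x H)" by (meson span_superset subset_insertI subset_trans)
    ultimately have "span (insert x H) = H" by (rule mx)
    then show "x \<in> H" using span_superset by blast
  qed
qed

lemma weight_components:
  assumes "x \<in> span (\<Union>\<alpha>\<in>P. root_space H \<alpha>)"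
  shows "\<exists>F f. finite F \<and> F \<subseteq> P \<and> (\<forall>\<alpha>\<in>F. f \<alpha> \<in> root_space H \<alpha>) \<and> x = sum f F"
  using assms
proof (induction rule: span_induct_alt)
  case base
  show ?case by (rule exI[of _ "{}"]) simp
next
  case (step c y z)
  then obtain \<alpha> F f where \<alpha>: "\<alpha> \<in> P" "y \<in> root_space H \<alpha>"
    and F: "finite F" "F \<subseteq> P" "\<forall>\<alpha>\<in>F. f \<alpha> \<in> root_space H \<alpha>" "z = sum f F" by auto
  let ?f = "\<lambda>\<beta>. (if \<beta> = \<alpha> then c *s y else 0) + (if \<beta> \<in> F then f \<beta> else 0)"
  note s = subspace_root_space[of H]
  have "(\<Sum>\<beta>\<in>insert \<alpha> F. if \<beta> = \<alpha> then c *s y else 0) = c *s y"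
    using F(1) by (simp add: sum.delta)
  moreover have "(\<Sum>\<beta>\<in>insert \<alpha> F. if \<beta> \<in> F then f \<beta> else 0) = sum f F"
    using F(1) by (intro sum.mono_neutral_cong_right) auto
  ultimately have "c *s y + z = sum ?f (insert \<alpha> F)"
    using F(4) by (simp only: sum.distrib)
  moreover have "\<forall>\<beta>\<in>insert \<alpha> F. ?f \<beta> \<in> root_space H \<beta>"
    using \<alpha> F(3) by (auto intro!: subspace_add[OF s] subspace_scale[OF s] subspace_0[OF s])
  ultimately show ?case using F \<alpha> by (intro exI[of _ "insert \<alpha> F"] exI[of _ ?f]) auto
qed

text \<open>The usual proof that eigenvectors for distinct eigenvalues are independent, relative to a
  stable subspace \<open>V\<close>.  With \<open>V = {0}\<close> it gives the independence of distinct weight spaces.\<close>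

lemma weight_component_mem:
  assumes V: "subspace V" and st: "\<And>h x. h \<in> H \<Longrightarrow> x \<in> V \<Longrightarrow> br h x \<in> V"
    and F: "finite F" "F \<subseteq> dual_space H" "\<And>\<alpha>. \<alpha> \<in> F \<Longrightarrow> f \<alpha> \<in> root_space H \<alpha>"
    and "sum f F \<in> V" "\<alpha> \<in> F"
  shows "f \<alpha> \<in> V"
  using F assms(6,7)
proof (induction F arbitrary: f \<alpha> rule: finite_induct)
  case (insert \<gamma> F)
  have F: "f \<beta> \<in> V" if \<beta>: "\<beta> \<in> F" for \<beta>
  proof -
    have "\<beta> \<noteq> \<gamma>" using \<beta> insert by auto
    then obtain h where h: "\<beta> h \<noteq> \<gamma> h" by auto
    have "h \<in> H"
      using h \<beta> insert.prems(1) unfolding dual_space_def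
      by (metis (mono_tags, lifting) insert_iff mem_Collect_eq subset_iff)
    \<comment> \<open>\<open>ad h - \<gamma> h\<close> kills the component of weight \<open>\<gamma>\<close> and rescales the others.\<close>
    let ?g = "\<lambda>\<beta>. (\<beta> h - \<gamma> h) *s f \<beta>"
    have eig: "br h (f \<gamma>) = \<gamma> h *s f \<gamma>" "br h (sum f F) = (\<Sum>\<beta>\<in>F. \<beta> h *s f \<beta>)"
      using insert.prems(2) \<open>h \<in> H\<close> unfolding br_sum_right root_space_def
      by (auto intro!: sum.cong)
    have "sum ?g F = br h (sum f (insert \<gamma> F)) - \<gamma> h *s sum f (insert \<gamma> F)"
      by (simp only: sum.insert[OF insert.hyps] br_add_right eig(1) eig(2) scale_right_distrib
          scale_sum_right scale_left_diff_distrib sum_subtractf add_diff_cancel_left)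
    also have "\<dots> \<in> V"
      by (intro subspace_diff[OF V] subspace_scale[OF V] st \<open>h \<in> H\<close> insert.prems(3))
    finally have "?g \<beta> \<in> V"
      using insert.prems(1,2) \<beta>
      by (intro insert.IH[where f = ?g] subspace_scale[OF subspace_root_space]) auto
    then have "inverse (\<beta> h - \<gamma> h) *s ?g \<beta> \<in> V" by (rule subspace_scale[OF V])
    moreover have "inverse (\<beta> h - \<gamma> h) *s ?g \<beta> = f \<beta>" using h by simp
    ultimately show ?thesis by (simp only:)
  qed
  have "f \<gamma> = sum f (insert \<gamma> F) - sum f F" using insert by simp
  also have "\<dots> \<in> V" by (intro subspace_diff[OF V] subspace_sum[OF V] insert.prems(3) F)
  finally show ?case using F insert.prems(4) by blast
qed simp

lemma weight_in_sum:
  assumes P: "P \<subseteq> dual_space H" and \<alpha>: "\<alpha> \<in> dual_space H" "x \<in> root_space H \<alpha>" "x \<noteq> 0"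
    and x: "x \<in> span (\<Union>\<alpha>\<in>P. root_space H \<alpha>)"
  shows "\<alpha> \<in> P"
proof (rule ccontr)
  assume n: "\<alpha> \<notin> P"
  obtain F f where F: "finite F" "F \<subseteq> P" "\<forall>\<alpha>\<in>F. f \<alpha> \<in> root_space H \<alpha>" "x = sum f F"
    using weight_components[OF x] by auto
  \<comment> \<open>Moving \<open>x\<close> to the other side gives a relation between vectors of distinct weights.\<close>
  let ?f = "f(\<alpha> := - x)"
  have "\<alpha> \<notin> F" using n F by auto
  then have "sum ?f F = sum f F" by (intro sum.cong) auto
  then have "sum ?f (insert \<alpha> F) \<in> {0}" using F \<open>\<alpha> \<notin> F\<close> by simp
  have "?f \<alpha> \<in> {0}"
  proof (rule weight_component_mem[where F = "insert \<alpha> F" and H = H and f = ?f])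
    show "insert \<alpha> F \<subseteq> dual_space H" using F(2) P \<alpha>(1) by blast
    show "?f \<beta> \<in> root_space H \<beta>" if "\<beta> \<in> insert \<alpha> F" for \<beta>
      using that F(3) subspace_neg[OF subspace_root_space \<alpha>(2)] by auto
    show "sum ?f (insert \<alpha> F) \<in> {0}" by fact
  qed (use F(1) in \<open>simp_all add: subspace_def\<close>)
  then show False using \<alpha> by simp
qed

section \<open>Simple coefficients\<close>

lemma root_coeff_unique:
  assumes B: "simple_basis H B" and k: "\<forall>\<alpha>. \<alpha> \<notin> B \<longrightarrow> k \<alpha> = 0"
    and \<beta>: "\<beta> = (\<lambda>x. \<Sum>\<alpha>\<in>B. of_int (k \<alpha>) * \<alpha> x)"
  shows "root_coeff B \<beta> = k"
  unfolding root_coeff_def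
proof (rule the_equality)
  fix l :: "('s \<Rightarrow> complex) \<Rightarrow> int"
  assume l: "(\<forall>\<alpha>. \<alpha> \<notin> B \<longrightarrow> l \<alpha> = 0) \<and> \<beta> = (\<lambda>x. \<Sum>\<alpha>\<in>B. of_int (l \<alpha>) * \<alpha> x)"
  have "(\<Sum>\<alpha>\<in>B. of_real (real_of_int (l \<alpha> - k \<alpha>)) * \<alpha> x) = 0" for x
  proof -
    have "(\<Sum>\<alpha>\<in>B. of_int (l \<alpha>) * \<alpha> x) = (\<Sum>\<alpha>\<in>B. of_int (k \<alpha>) * \<alpha> x)"
      using l \<beta> by metis
    then show ?thesis by (simp add: algebra_simps sum_subtractf)
  qed
  moreover have "\<forall>c::('s \<Rightarrow> complex) \<Rightarrow> real.
      (\<forall>x. (\<Sum>\<alpha>\<in>B. of_real (c \<alpha>) * \<alpha> x) = 0) \<longrightarrow> (\<forall>\<alpha>\<in>B. c \<alpha> = 0)"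
    using B unfolding simple_basis_def by blast
  ultimately have "\<forall>\<alpha>\<in>B. real_of_int (l \<alpha> - k \<alpha>) = 0"
    by (elim allE[where x = "\<lambda>\<alpha>. real_of_int (l \<alpha> - k \<alpha>)"]) simp
  then show "l = k" using l k by (intro ext) (metis eq_iff_diff_eq_0 of_int_eq_0_iff)
next
  show "(\<forall>\<alpha>. \<alpha> \<notin> B \<longrightarrow> k \<alpha> = 0) \<and> \<beta> = (\<lambda>x. \<Sum>\<alpha>\<in>B. of_int (k \<alpha>) * \<alpha> x)"
    using k \<beta> by blast
qed

lemma root_coeff_root:
  assumes B: "simple_basis H B" and \<beta>: "\<beta> \<in> roots H"
  shows "\<forall>\<alpha>. \<alpha> \<notin> B \<longrightarrow> root_coeff B \<beta> \<alpha> = 0"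
    and "\<beta> = (\<lambda>x. \<Sum>\<alpha>\<in>B. of_int (root_coeff B \<beta> \<alpha>) * \<alpha> x)"
proof -
  obtain k :: "('s \<Rightarrow> complex) \<Rightarrow> int" where k: "\<beta> = (\<lambda>x. \<Sum>\<alpha>\<in>B. of_int (k \<alpha>) * \<alpha> x)"
    using B \<beta> unfolding simple_basis_def by blast
  let ?k = "\<lambda>\<alpha>. if \<alpha> \<in> B then k \<alpha> else 0"
  have "\<beta> = (\<lambda>x. \<Sum>\<alpha>\<in>B. of_int (?k \<alpha>) * \<alpha> x)" unfolding k by (intro ext sum.cong) auto
  moreover from this have "root_coeff B \<beta> = ?k"
    by (intro root_coeff_unique[OF B]) simp_all
  ultimately show "\<beta> = (\<lambda>x. \<Sum>\<alpha>\<in>B. of_int (root_coeff B \<beta> \<alpha>) * \<alpha> x)"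
    by (simp only:)
  show "\<forall>\<alpha>. \<alpha> \<notin> B \<longrightarrow> root_coeff B \<beta> \<alpha> = 0"
    unfolding \<open>root_coeff B \<beta> = ?k\<close> by simp
qed

lemma xi_zero: "simple_basis H B \<Longrightarrow> xi B \<Phi> 0 = 0"
  using root_coeff_unique[of H B "\<lambda>_. 0" 0] by (simp add: xi_def zero_fun_def)

lemma xi_add:
  assumes "simple_basis H B" "\<alpha> \<in> roots H" "\<beta> \<in> roots H"
  shows "xi B \<Phi> (\<alpha> + \<beta>) = xi B \<Phi> \<alpha> + xi B \<Phi> \<beta>"
proof -
  note c = root_coeff_root[OF assms(1)]
  have "(\<alpha> + \<beta>) x = (\<Sum>\<gamma>\<in>B. of_int (root_coeff B \<alpha> \<gamma> + root_coeff B \<beta> \<gamma>) * \<gamma> x)" for x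
    using fun_cong[OF c(2)[OF assms(2)], of x] fun_cong[OF c(2)[OF assms(3)], of x]
    by (simp only: plus_fun_apply of_int_add distrib_right sum.distrib)
  then have "root_coeff B (\<alpha> + \<beta>) = (\<lambda>\<gamma>. root_coeff B \<alpha> \<gamma> + root_coeff B \<beta> \<gamma>)"
    using c(1)[OF assms(2)] c(1)[OF assms(3)]
    by (intro root_coeff_unique[OF assms(1)] ext) simp_all
  then show ?thesis by (simp add: xi_def sum.distrib)
qed

lemma xi_uminus:
  assumes "simple_basis H B" "\<alpha> \<in> roots H"
  shows "xi B \<Phi> (- \<alpha>) = - xi B \<Phi> \<alpha>"
proof -
  note c = root_coeff_root[OF assms]
  have "- \<alpha> = (\<lambda>x. \<Sum>\<gamma>\<in>B. of_int (- root_coeff B \<alpha> \<gamma>) * \<gamma> x)"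
    using fun_cong[OF c(2)] by (intro ext)
      (simp only: fun_Compl_def of_int_minus minus_mult_left[symmetric] sum_negf)
  then have "root_coeff B (- \<alpha>) = (\<lambda>\<gamma>. - root_coeff B \<alpha> \<gamma>)"
    using c(1) by (intro root_coeff_unique[OF assms(1)]) simp_all
  then show ?thesis by (simp add: xi_def sum_negf)
qed

end

section \<open>A parabolic subalgebra and its conjugate\<close>

locale conjugate_parabolic = complex_lie_algebra scale br
  for scale :: "complex \<Rightarrow> 's::ab_group_add \<Rightarrow> 's" (infixr \<open>*s\<close> 75)
    and br :: "'s \<Rightarrow> 's \<Rightarrow> 's" +
  fixes \<sigma> :: "'s \<Rightarrow> 's" and H :: "'s set" and B \<Phi> :: "('s \<Rightarrow> complex) set"
  assumes involution: "antilinear_involution \<sigma>"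
    and cartan: "cartan_subalgebra H"
    and stable: "\<sigma> ` H = H"
    and simple: "simple_basis H B"
begin

abbreviation \<qq> :: "'s set" where "\<qq> \<equiv> parabolic H B \<Phi>"

definition conj_weight :: "('s \<Rightarrow> complex) \<Rightarrow> ('s \<Rightarrow> complex)" where
  "conj_weight \<beta> = (\<lambda>x. cnj (\<beta> (\<sigma> x)))"

text \<open>The weight \<open>0\<close> is included to account for \<open>H\<close>, so that \<open>\<qq>\<close> is the sum of the weight spaces
  of these weights.\<close>

definition weights :: "('s \<Rightarrow> complex) set" where
  "weights = insert 0 (Q_set H B \<Phi>)"

lemma sigma_add: "\<sigma> (x + y) = \<sigma> x + \<sigma> y"
  and sigma_scale: "\<sigma> (c *s x) = cnj c *s \<sigma> x"
  and sigma_br: "\<sigma> (br x y) = br (\<sigma> x) (\<sigma> y)"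
  and sigma_sigma [simp]: "\<sigma> (\<sigma> x) = x"
  using involution by (simp_all add: antilinear_involution_def)

lemma sigma_zero: "\<sigma> 0 = 0"
  using sigma_add[of 0 0] by simp

lemma sigma_cartan: "\<sigma> x \<in> H \<longleftrightarrow> x \<in> H"
  using stable sigma_sigma by (metis imageI)

lemma subspace_image_sigma: "subspace V \<Longrightarrow> subspace (\<sigma> ` V)"
proof -
  assume V: "subspace V"
  have eq: "\<sigma> ` V = {x. \<sigma> x \<in> V}" by (force simp: image_iff)
  show ?thesis
    unfolding eq using V by (simp add: subspace_def sigma_add sigma_scale sigma_zero)
qed

lemma conj_weight_conj_weight [simp]: "conj_weight (conj_weight \<beta>) = \<beta>"
  by (simp add: conj_weight_def)

lemma conj_weight_add: "conj_weight (\<alpha> + \<beta>) = conj_weight \<alpha> + conj_weight \<beta>"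
  by (simp add: conj_weight_def fun_eq_iff)

lemma conj_weight_zero: "conj_weight 0 = 0"
  by (simp add: conj_weight_def fun_eq_iff)

lemma conj_weight_dual: "\<beta> \<in> dual_space H \<Longrightarrow> conj_weight \<beta> \<in> dual_space H"
  by (simp add: dual_space_def conj_weight_def sigma_add sigma_scale sigma_cartan)

lemma image_sigma_root_space: "\<sigma> ` root_space H \<beta> = root_space H (conj_weight \<beta>)"
proof -
  have sub: "\<sigma> x \<in> root_space H (conj_weight \<gamma>)" if "x \<in> root_space H \<gamma>" for \<gamma> x
    unfolding root_space_def
  proof (intro CollectI ballI)
    fix h assume "h \<in> H"
    then have "br (\<sigma> h) x = \<gamma> (\<sigma> h) *s x"
      using that sigma_cartan by (simp add: root_space_def)
    then have "\<sigma> (br (\<sigma> h) x) = cnj (\<gamma> (\<sigma> h)) *s \<sigma> x" by (simp only: sigma_scale)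
    then show "br h (\<sigma> x) = conj_weight \<gamma> h *s \<sigma> x"
      by (simp add: sigma_br conj_weight_def)
  qed
  show ?thesis
  proof (intro set_eqI iffI)
    fix x assume "x \<in> root_space H (conj_weight \<beta>)"
    then have "\<sigma> x \<in> root_space H \<beta>" using sub[of x "conj_weight \<beta>"] by simp
    then show "x \<in> \<sigma> ` root_space H \<beta>" by (metis imageI sigma_sigma)
  qed (use sub in auto)
qed

lemma conj_weight_root:
  assumes "\<beta> \<in> roots H" shows "conj_weight \<beta> \<in> roots H"
proof -
  have \<beta>: "\<beta> \<in> dual_space H" "\<beta> \<noteq> 0" "root_space H \<beta> \<noteq> {0}"
    using assms by (simp_all add: roots_def zero_fun_def)
  obtain x where x: "x \<in> root_space H \<beta>" "x \<noteq> 0"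
    using \<beta>(3) subspace_0[OF subspace_root_space] by blast
  have "\<sigma> x \<in> root_space H (conj_weight \<beta>)" using x image_sigma_root_space by blast
  moreover have "\<sigma> x \<noteq> 0" using x sigma_sigma[of x] sigma_zero by metis
  moreover have "conj_weight \<beta> \<noteq> 0"
    using \<beta>(2) conj_weight_conj_weight[of \<beta>] conj_weight_zero by metis
  ultimately show ?thesis using rootsI conj_weight_dual[OF \<beta>(1)] by blast
qed

text \<open>The definite description of the conjugate root is well posed because a nonzero weight
  space determines its weight.\<close>

lemma conj_root_eq:
  assumes "\<beta> \<in> roots H" shows "conj_root H \<sigma> \<beta> = conj_weight \<beta>"
  unfolding conj_root_def
proof (rule the_equality)
  show "conj_weight \<beta> \<in> roots H \<and> \<sigma> ` root_space H \<beta> = root_space H (conj_weight \<beta>)"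
    using conj_weight_root[OF assms] image_sigma_root_space by blast
next
  fix \<gamma> assume \<gamma>: "\<gamma> \<in> roots H \<and> \<sigma> ` root_space H \<beta> = root_space H \<gamma>"
  then have eq: "root_space H \<gamma> = root_space H (conj_weight \<beta>)"
    by (simp add: image_sigma_root_space)
  have "root_space H \<gamma> \<noteq> {0}" using \<gamma> by (simp add: roots_def)
  then obtain x where x: "x \<in> root_space H \<gamma>" "x \<noteq> 0"
    using subspace_0[OF subspace_root_space] by blast
  have "\<gamma> h = conj_weight \<beta> h" if "h \<in> H" for h
  proof -
    have "\<gamma> h *s x = conj_weight \<beta> h *s x"
      using x(1) x(1)[unfolded eq] that unfolding root_space_def by force
    then show ?thesis using x(2) scale_right_imp_eq by blast
  qed
  moreover have "\<gamma> h = conj_weight \<beta> h" if "h \<notin> H" for h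
    using \<gamma> conj_weight_root[OF assms] that by (simp add: roots_def dual_space_def)
  ultimately show "\<gamma> = conj_weight \<beta>" by (intro ext) blast
qed

lemma weights_dual: "weights \<subseteq> dual_space H"
  using dual_space_zero by (auto simp: weights_def Q_set_def roots_def)

lemma weights_iff:
  "\<alpha> = 0 \<or> \<alpha> \<in> roots H \<Longrightarrow> \<alpha> \<in> weights \<longleftrightarrow> xi B \<Phi> \<alpha> \<le> 0"
  using xi_zero[OF simple, of \<Phi>] by (auto simp: weights_def Q_set_def)

lemma parabolic_eq_span: "\<qq> = span (\<Union>\<alpha>\<in>weights. root_space H \<alpha>)"
  unfolding parabolic_def weights_def using root_space_cartan_0[OF cartan] by simp

lemma sigma_parabolic_eq_span: "\<sigma> ` \<qq> = span (\<Union>\<alpha>\<in>conj_weight ` weights. root_space H \<alpha>)"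
proof
  have "root_space H (conj_weight \<alpha>) \<subseteq> \<sigma> ` \<qq>" if "\<alpha> \<in> weights" for \<alpha>
    unfolding image_sigma_root_space[symmetric] parabolic_eq_span
    using that span_superset by blast
  then show "span (\<Union>\<alpha>\<in>conj_weight ` weights. root_space H \<alpha>) \<subseteq> \<sigma> ` \<qq>"
    by (intro span_minimal subspace_image_sigma) (auto simp: parabolic_eq_span)
next
  let ?R = "span (\<Union>\<alpha>\<in>conj_weight ` weights. root_space H \<alpha>)"
  have "root_space H \<alpha> \<subseteq> \<sigma> ` ?R" if "\<alpha> \<in> weights" for \<alpha>
  proof -
    have "root_space H (conj_weight \<alpha>) \<subseteq> ?R"
      by (rule subset_trans[OF UN_upper span_superset]) (use that in simp)
    then have "\<sigma> ` root_space H (conj_weight \<alpha>) \<subseteq> \<sigma> ` ?R" by blast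
    then show ?thesis by (simp add: image_sigma_root_space)
  qed
  then have "\<qq> \<subseteq> \<sigma> ` ?R"
    unfolding parabolic_eq_span by (intro span_minimal subspace_image_sigma) auto
  then have "\<sigma> ` \<qq> \<subseteq> \<sigma> ` \<sigma> ` ?R" by blast
  then show "\<sigma> ` \<qq> \<subseteq> ?R" by (simp add: image_image)
qed

lemma subspace_parabolic: "subspace \<qq>"
  by (simp add: parabolic_eq_span)

lemma subspace_sigma_parabolic: "subspace (\<sigma> ` \<qq>)"
  by (simp add: sigma_parabolic_eq_span)

lemma root_space_subset_parabolic: "\<alpha> \<in> weights \<Longrightarrow> root_space H \<alpha> \<subseteq> \<qq>"
  unfolding parabolic_eq_span using span_superset by blast

lemma root_space_subset_sigma_parabolic: "conj_weight \<alpha> \<in> weights \<Longrightarrow> root_space H \<alpha> \<subseteq> \<sigma> ` \<qq>"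
  unfolding sigma_parabolic_eq_span using span_superset[of "\<Union>\<alpha>\<in>conj_weight ` weights. root_space H \<alpha>"]
  by (force simp: image_iff)

lemma cartan_subset: "H \<subseteq> \<qq> \<inter> \<sigma> ` \<qq>"
  using root_space_subset_parabolic[of 0] root_space_subset_sigma_parabolic[of 0]
  by (simp add: root_space_cartan_0[OF cartan] conj_weight_zero weights_def)

lemma root_or_zero:
  "\<alpha> \<in> dual_space H \<Longrightarrow> x \<in> root_space H \<alpha> \<Longrightarrow> x \<noteq> 0 \<Longrightarrow> \<alpha> = 0 \<or> \<alpha> \<in> roots H"
  using rootsI by blast

lemma xi_add_weights:
  assumes "\<alpha> = 0 \<or> \<alpha> \<in> roots H" "\<beta> = 0 \<or> \<beta> \<in> roots H"
  shows "xi B \<Phi> (\<alpha> + \<beta>) = xi B \<Phi> \<alpha> + xi B \<Phi> \<beta>"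
  using assms xi_add[OF simple] xi_zero[OF simple] by auto

lemma weights_root_or_zero: "\<alpha> \<in> weights \<Longrightarrow> \<alpha> = 0 \<or> \<alpha> \<in> roots H"
  by (auto simp: weights_def Q_set_def)

lemma br_closed_parabolic: "br_closed \<qq>"
proof -
  let ?G = "\<Union>\<alpha>\<in>weights. root_space H \<alpha>"
  have gen: "br x y \<in> \<qq>" if "x \<in> ?G" "y \<in> ?G" for x y
  proof (cases "br x y = 0")
    case False
    obtain \<alpha> \<beta> where \<alpha>: "\<alpha> \<in> weights" "x \<in> root_space H \<alpha>"
      and \<beta>: "\<beta> \<in> weights" "y \<in> root_space H \<beta>"
      using \<open>x \<in> ?G\<close> \<open>y \<in> ?G\<close> by blast
    have *: "br x y \<in> root_space H (\<alpha> + \<beta>)" by (rule br_root_space[OF \<alpha>(2) \<beta>(2)])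
    have z: "\<alpha> + \<beta> = 0 \<or> \<alpha> + \<beta> \<in> roots H"
      by (rule root_or_zero[OF dual_space_add * False]) (use \<alpha> \<beta> weights_dual in blast)+
    note w = weights_root_or_zero[OF \<alpha>(1)] weights_root_or_zero[OF \<beta>(1)]
    have "xi B \<Phi> (\<alpha> + \<beta>) \<le> 0"
      using \<alpha>(1) \<beta>(1) xi_add_weights[OF w] weights_iff[OF w(1)] weights_iff[OF w(2)] by simp
    then have "\<alpha> + \<beta> \<in> weights" using weights_iff[OF z] by blast
    then show ?thesis using * root_space_subset_parabolic by blast
  qed (simp add: subspace_0[OF subspace_parabolic])
  have "br x y \<in> \<qq>" if x: "x \<in> \<qq>" and y: "y \<in> \<qq>" for x y
  proof -
    have 1: "br x y \<in> \<qq>" if "x \<in> ?G" for x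
      using y unfolding parabolic_eq_span
    proof (rule span_induct)
      show "subspace {y. br x y \<in> span ?G}" by (intro subspace_br_right subspace_span)
      show "br x y \<in> span ?G" if "y \<in> ?G" for y
        using gen[OF \<open>x \<in> ?G\<close> that] by (simp only: parabolic_eq_span)
    qed
    have 2: "subspace {x. br x y \<in> \<qq>}"
      using subspace_ball_br[OF subspace_parabolic, of "{y}"] by simp
    from x[unfolded parabolic_eq_span] show ?thesis by (rule span_induct) (rule 2, rule 1)
  qed
  then show ?thesis by (simp add: br_closed_def)
qed

lemma br_closed_sigma_parabolic: "br_closed (\<sigma> ` \<qq>)"
  using br_closed_parabolic by (auto simp: br_closed_def sigma_br[symmetric])

text \<open>Both \<open>\<qq>\<close> and \<open>\<sigma> ` \<qq>\<close> are sums of weight spaces, so independence of weight spaces leaves no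
  other weight for a nonzero vector of their sum.\<close>

lemma weight_of_sum:
  assumes "\<alpha> \<in> dual_space H" "x \<in> root_space H \<alpha>" "x \<noteq> 0" "x \<in> \<qq> + \<sigma> ` \<qq>"
  shows "\<alpha> \<in> weights \<or> conj_weight \<alpha> \<in> weights"
proof -
  let ?P = "weights \<union> conj_weight ` weights"
  have "\<qq> \<subseteq> span (\<Union>\<alpha>\<in>?P. root_space H \<alpha>)" "\<sigma> ` \<qq> \<subseteq> span (\<Union>\<alpha>\<in>?P. root_space H \<alpha>)"
    by (simp only: parabolic_eq_span, rule span_mono, blast)
      (simp only: sigma_parabolic_eq_span, rule span_mono, blast)
  then have "x \<in> span (\<Union>\<alpha>\<in>?P. root_space H \<alpha>)"
    using assms(4) by (auto elim!: set_plus_elim intro!: span_add)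
  moreover have "?P \<subseteq> dual_space H" using weights_dual conj_weight_dual by blast
  ultimately have "\<alpha> \<in> ?P" using weight_in_sum[of ?P H \<alpha> x] assms by blast
  then show ?thesis by auto
qed

text \<open>The root that lies in \<open>Q\<^sup>c\<close> and in the conjugate of \<open>Q\<^sup>n\<close> is the conjugate of \<open>\<beta>\<close>; being
  imaginary passes from a root to its conjugate.\<close>

lemma minimal_typeD:
  assumes min: "minimal_type H \<sigma> B \<Phi>"
    and \<beta>: "\<beta> \<in> weights" "conj_weight \<beta> \<notin> weights" "xi B \<Phi> \<beta> < 0"
  shows "conj_weight \<beta> = - \<beta>"
proof -
  have "\<beta> \<noteq> 0" using \<beta>(3) xi_zero[OF simple] by auto
  then have r: "\<beta> \<in> roots H" using \<beta>(1) weights_root_or_zero by blast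
  note r' = conj_weight_root[OF r]
  have "conj_weight \<beta> \<in> Qc_set H B \<Phi>"
    using weights_iff[of "conj_weight \<beta>"] \<beta>(2) r' by (simp add: Qc_set_def)
  moreover have "conj_weight \<beta> \<in> conj_root H \<sigma> ` Qn_set H B \<Phi>"
    using r \<beta>(3) by (intro image_eqI[of _ _ \<beta>]) (simp_all add: conj_root_eq Qn_set_def)
  ultimately have "conj_weight \<beta> \<in> imaginary_roots H \<sigma>"
    using min unfolding minimal_type_def by blast
  then have "\<beta> = - conj_weight \<beta>"
    using conj_root_eq[OF r'] by (simp add: imaginary_roots_def)
  then show ?thesis by (simp add: fun_eq_iff fun_Compl_def)
qed

section \<open>Threefold brackets\<close>

abbreviation \<SS> :: "'s set" where "\<SS> \<equiv> \<qq> + \<sigma> ` \<qq>"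

abbreviation triple :: "'s \<Rightarrow> 's \<Rightarrow> 's \<Rightarrow> 's \<Rightarrow> 's" where
  "triple Z U V W \<equiv> br (br (br Z U) V) W"

lemma subspace_total: "subspace \<SS>"
  by (rule subspace_set_plus[OF subspace_parabolic subspace_sigma_parabolic])

lemma subset_total: "\<qq> \<subseteq> \<SS>" "\<sigma> ` \<qq> \<subseteq> \<SS>"
  by (rule subset_set_plus[OF subspace_parabolic subspace_sigma_parabolic])+

lemma total_br_Int:
  assumes "X \<in> \<SS>" "W \<in> \<qq>" "W \<in> \<sigma> ` \<qq>" shows "br X W \<in> \<SS>"
proof -
  obtain a b where X: "X = a + b" "a \<in> \<qq>" "b \<in> \<sigma> ` \<qq>"
    using set_plus_elim[OF assms(1)] by blast
  show ?thesis
    unfolding X(1) br_add_left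
    by (intro set_plus_intro br_closedD[OF br_closed_parabolic X(2) assms(2)]
        br_closedD[OF br_closed_sigma_parabolic X(3) assms(3)])
qed

lemma levi_chain_iff_iterated:
  "Z \<in> levi_chain \<sigma> \<qq> n \<longleftrightarrow>
    Z \<in> \<qq> \<and> (\<forall>ws. set ws \<subseteq> \<sigma> ` \<qq> \<and> length ws \<le> n \<longrightarrow> foldl br Z ws \<in> \<SS>)"
  by (rule levi_chain_iff[OF subspace_parabolic subspace_sigma_parabolic br_closed_sigma_parabolic])

lemma levi_chain_2D:
  assumes "Z \<in> levi_chain \<sigma> \<qq> 2"
  shows "Z \<in> \<qq>" "U \<in> \<sigma> ` \<qq> \<Longrightarrow> br Z U \<in> \<SS>"
    "U \<in> \<sigma> ` \<qq> \<Longrightarrow> V \<in> \<sigma> ` \<qq> \<Longrightarrow> br (br Z U) V \<in> \<SS>"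
proof -
  have Z: "Z \<in> \<qq>" and it: "\<And>ws. set ws \<subseteq> \<sigma> ` \<qq> \<Longrightarrow> length ws \<le> 2 \<Longrightarrow> foldl br Z ws \<in> \<SS>"
    using assms unfolding levi_chain_iff_iterated by blast+
  show "Z \<in> \<qq>" by (fact Z)
  show "br Z U \<in> \<SS>" if "U \<in> \<sigma> ` \<qq>" using it[of "[U]"] that by simp
  show "br (br Z U) V \<in> \<SS>" if "U \<in> \<sigma> ` \<qq>" "V \<in> \<sigma> ` \<qq>" using it[of "[U, V]"] that by simp
qed

text \<open>The correction terms are twofold brackets of \<open>Z\<close> with elements of \<open>\<sigma> ` \<qq>\<close>, one of which is
  \<open>[U, V]\<close> or \<open>[V, W]\<close>, and membership in the second term of the chain puts these into \<open>\<SS>\<close>.\<close>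

lemma triple_swap:
  assumes Z: "Z \<in> levi_chain \<sigma> \<qq> 2" and "U \<in> \<sigma> ` \<qq>" "V \<in> \<sigma> ` \<qq>" "W \<in> \<sigma> ` \<qq>"
  shows "triple Z U V W \<in> \<SS> \<longleftrightarrow> triple Z V U W \<in> \<SS>"
    and "triple Z U V W \<in> \<SS> \<longleftrightarrow> triple Z U W V \<in> \<SS>"
proof -
  note cl = br_closedD[OF br_closed_sigma_parabolic]
  have cancel: "X \<in> \<SS> \<longleftrightarrow> Y \<in> \<SS>" if "X = Y + D" "D \<in> \<SS>" for X Y D
  proof -
    have "Y = X - D" using that(1) by simp
    then show ?thesis
      using that subspace_add[OF subspace_total] subspace_diff[OF subspace_total] by metis
  qed
  have "triple Z U V W = triple Z V U W + br (br Z (br U V)) W"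
    by (simp only: br_br_swap[of Z U V] br_add_left)
  then show "triple Z U V W \<in> \<SS> \<longleftrightarrow> triple Z V U W \<in> \<SS>"
    by (rule cancel) (intro levi_chain_2D(3)[OF Z] cl assms)
  have "triple Z U V W = triple Z U W V + br (br Z U) (br V W)"
    by (rule br_br_swap)
  then show "triple Z U V W \<in> \<SS> \<longleftrightarrow> triple Z U W V \<in> \<SS>"
    by (rule cancel) (intro levi_chain_2D(3)[OF Z] cl assms)
qed

text \<open>An argument in \<open>\<qq>\<close> is moved to the last place, where it acts on a vector of \<open>\<SS>\<close>.\<close>

lemma triple_parabolic:
  assumes Z: "Z \<in> levi_chain \<sigma> \<qq> 2" and R: "U \<in> \<sigma> ` \<qq>" "V \<in> \<sigma> ` \<qq>" "W \<in> \<sigma> ` \<qq>"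
    and q: "U \<in> \<qq> \<or> V \<in> \<qq> \<or> W \<in> \<qq>"
  shows "triple Z U V W \<in> \<SS>"
proof -
  have last: "triple Z X Y Y' \<in> \<SS>" if "X \<in> \<sigma> ` \<qq>" "Y \<in> \<sigma> ` \<qq>" "Y' \<in> \<sigma> ` \<qq>" "Y' \<in> \<qq>" for X Y Y'
    using total_br_Int levi_chain_2D(3)[OF Z] that by blast
  note sw = triple_swap[OF Z]
  from q consider "U \<in> \<qq>" | "V \<in> \<qq>" | "W \<in> \<qq>" by blast
  then show ?thesis
  proof cases
    case 1
    then have "triple Z V W U \<in> \<SS>" using last R by blast
    then show ?thesis using sw(1)[OF R] sw(2)[OF R(2,1,3)] by blast
  next
    case 2
    then have "triple Z U W V \<in> \<SS>" using last R by blast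
    then show ?thesis using sw(2)[OF R] by blast
  qed (use last R in blast)
qed

lemma defect_weight:
  assumes "\<gamma> \<in> dual_space H" "X \<in> root_space H \<gamma>" "X \<in> \<SS>" "X \<notin> \<sigma> ` \<qq>"
  shows "\<gamma> \<in> weights \<and> conj_weight \<gamma> \<notin> weights"
  using weight_of_sum[OF assms(1,2) _ assms(3)] assms(2,4)
    root_space_subset_sigma_parabolic[of \<gamma>] subspace_0[OF subspace_sigma_parabolic] by blast

text \<open>The heart of the argument.  A third bracket that leaves \<open>\<SS>\<close> leaves room for two steps on which
  \<open>\<xi>\<close> increases while staying nonpositive.  So \<open>\<xi>\<close> is negative before the second step, where
  minimal type applies both to \<open>\<beta>\<close> and to \<open>\<beta> + \<alpha>\<close>, and their difference is imaginary too.\<close>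

lemma imaginary_step:
  assumes min: "minimal_type H \<sigma> B \<Phi>" and Z: "Z \<in> levi_chain \<sigma> \<qq> 2" "Z \<in> root_space H \<beta>"
    and U: "U \<in> root_space H \<alpha>" "U \<in> \<sigma> ` \<qq>" and V: "V \<in> root_space H \<gamma>" "V \<in> \<sigma> ` \<qq>"
    and W: "W \<in> \<sigma> ` \<qq>"
    and dual: "\<beta> \<in> dual_space H" "\<alpha> \<in> dual_space H" "\<gamma> \<in> dual_space H"
    and T: "triple Z U V W \<notin> \<SS>"
  shows "conj_weight \<beta> = - \<beta>" "conj_weight \<alpha> = - \<alpha>"
proof -
  note cl = br_closedD[OF br_closed_sigma_parabolic]
  have positive: "(\<delta> = 0 \<or> \<delta> \<in> roots H) \<and> xi B \<Phi> \<delta> > 0"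
    if "X \<in> root_space H \<delta>" "\<delta> \<in> dual_space H" "X \<notin> \<qq>" for X \<delta>
  proof -
    have "X \<noteq> 0" using that(3) subspace_0[OF subspace_parabolic] by blast
    then have "\<delta> = 0 \<or> \<delta> \<in> roots H" using root_or_zero that by blast
    moreover have "\<delta> \<notin> weights" using that root_space_subset_parabolic by blast
    ultimately show ?thesis using weights_iff by force
  qed
  have "U \<notin> \<qq>" "V \<notin> \<qq>" using triple_parabolic[OF Z(1) U(2) V(2) W] T by blast+
  then have p\<alpha>: "\<alpha> = 0 \<or> \<alpha> \<in> roots H" "xi B \<Phi> \<alpha> > 0"
    and p\<gamma>: "\<gamma> = 0 \<or> \<gamma> \<in> roots H" "xi B \<Phi> \<gamma> > 0"
    using positive[OF U(1) dual(2)] positive[OF V(1) dual(3)] by blast+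
  \<comment> \<open>Once in the conjugate subalgebra, further brackets would remain there.\<close>
  have "triple Z U V W \<notin> \<sigma> ` \<qq>" using T subset_total by blast
  then have nR: "Z \<notin> \<sigma> ` \<qq>" "br Z U \<notin> \<sigma> ` \<qq>" "br (br Z U) V \<notin> \<sigma> ` \<qq>"
    using cl U(2) V(2) W by metis+
  have ZU: "br Z U \<in> root_space H (\<beta> + \<alpha>)" and ZUV: "br (br Z U) V \<in> root_space H (\<beta> + \<alpha> + \<gamma>)"
    using br_root_space Z(2) U(1) V(1) by blast+
  have d0: "\<beta> \<in> weights" "conj_weight \<beta> \<notin> weights"
    using defect_weight[OF dual(1) Z(2)] nR(1) levi_chain_2D(1)[OF Z(1)] subset_total(1) by blast+
  have d1: "\<beta> + \<alpha> \<in> weights" "conj_weight (\<beta> + \<alpha>) \<notin> weights"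
    using defect_weight[OF dual_space_add[OF dual(1,2)] ZU] nR(2) levi_chain_2D(2)[OF Z(1) U(2)]
    by blast+
  have d2: "\<beta> + \<alpha> + \<gamma> \<in> weights"
    using defect_weight[OF dual_space_add[OF dual_space_add[OF dual(1,2)] dual(3)] ZUV] nR(3)
      levi_chain_2D(3)[OF Z(1) U(2) V(2)] by blast
  have "xi B \<Phi> (\<beta> + \<alpha> + \<gamma>) \<le> 0" using d2 weights_iff weights_root_or_zero by blast
  then have x1: "xi B \<Phi> (\<beta> + \<alpha>) < 0"
    using xi_add_weights[OF weights_root_or_zero[OF d1(1)] p\<gamma>(1)] p\<gamma>(2) by linarith
  then have x0: "xi B \<Phi> \<beta> < 0"
    using xi_add_weights[OF weights_root_or_zero[OF d0(1)] p\<alpha>(1)] p\<alpha>(2) by linarith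
  show b: "conj_weight \<beta> = - \<beta>" by (rule minimal_typeD[OF min d0 x0])
  have "conj_weight (\<beta> + \<alpha>) = - (\<beta> + \<alpha>)" by (rule minimal_typeD[OF min d1 x1])
  then show "conj_weight \<alpha> = - \<alpha>"
    using b by (simp add: conj_weight_add fun_eq_iff fun_Compl_def)
qed

text \<open>Moving each of the three arguments to the front shows that all their weights are imaginary.
  Then so is the weight of the triple bracket, and \<open>\<xi>\<close> and its conjugate have opposite signs on it,
  so that the bracket cannot leave both \<open>\<qq>\<close> and \<open>\<sigma> ` \<qq>\<close>.\<close>

lemma triple_weight_vectors:
  assumes min: "minimal_type H \<sigma> B \<Phi>" and Z: "Z \<in> levi_chain \<sigma> \<qq> 2" "Z \<in> root_space H \<beta>"
    and U: "U \<in> root_space H \<alpha>" "U \<in> \<sigma> ` \<qq>" and V: "V \<in> root_space H \<gamma>" "V \<in> \<sigma> ` \<qq>"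
    and W: "W \<in> root_space H \<delta>" "W \<in> \<sigma> ` \<qq>"
    and dual: "\<beta> \<in> dual_space H" "\<alpha> \<in> dual_space H" "\<gamma> \<in> dual_space H" "\<delta> \<in> dual_space H"
  shows "triple Z U V W \<in> \<SS>"
proof (rule ccontr)
  assume T: "triple Z U V W \<notin> \<SS>"
  note sw = triple_swap[OF Z(1)]
  have T2: "triple Z V U W \<notin> \<SS>" using T sw(1)[OF U(2) V(2) W(2)] by blast
  have "triple Z U W V \<notin> \<SS>" using T sw(2)[OF U(2) V(2) W(2)] by blast
  then have T3: "triple Z W U V \<notin> \<SS>" using sw(1)[OF U(2) W(2) V(2)] by blast
  let ?\<omega> = "\<beta> + \<alpha> + \<gamma> + \<delta>"
  have "conj_weight \<beta> = - \<beta>" "conj_weight \<alpha> = - \<alpha>"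
    by (rule imaginary_step[OF min Z U V W(2) dual(1-3) T])+
  moreover have "conj_weight \<gamma> = - \<gamma>"
    by (rule imaginary_step(2)[OF min Z V U W(2) dual(1,3,2) T2])
  moreover have "conj_weight \<delta> = - \<delta>"
    by (rule imaginary_step(2)[OF min Z W U V(2) dual(1,4,2) T3])
  ultimately have conj: "conj_weight ?\<omega> = - ?\<omega>"
    by (simp add: conj_weight_add fun_eq_iff fun_Compl_def)
  have mem: "triple Z U V W \<in> root_space H ?\<omega>"
    by (intro br_root_space Z U V W)
  have "triple Z U V W \<noteq> 0" using T subspace_0[OF subspace_total] by metis
  then have "?\<omega> = 0 \<or> ?\<omega> \<in> roots H"
    by (intro root_or_zero[OF _ mem] dual_space_add dual)
  moreover have w: "?\<omega> \<notin> weights" "conj_weight ?\<omega> \<notin> weights"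
    using T mem root_space_subset_parabolic root_space_subset_sigma_parabolic subset_total by blast+
  moreover have "0 \<in> weights" by (simp add: weights_def)
  ultimately have r: "?\<omega> \<in> roots H" by metis
  have "xi B \<Phi> ?\<omega> > 0" using w(1) r weights_iff by force
  moreover have "xi B \<Phi> (- ?\<omega>) > 0"
    using w(2) conj_weight_root[OF r] weights_iff unfolding conj by force
  ultimately show False using xi_uminus[OF simple r, of \<Phi>] by linarith
qed

lemma span_induct_sigma_parabolic:
  assumes "X \<in> \<sigma> ` \<qq>" "subspace {X. P X}"
    and "\<And>\<alpha> X. \<alpha> \<in> dual_space H \<Longrightarrow> X \<in> root_space H \<alpha> \<Longrightarrow> X \<in> \<sigma> ` \<qq> \<Longrightarrow> P X"
  shows "P X"
  using assms(1)[unfolded sigma_parabolic_eq_span]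
proof (rule span_induct)
  show "subspace (Collect P)" using assms(2) by simp
  fix Y assume "Y \<in> (\<Union>\<alpha>\<in>conj_weight ` weights. root_space H \<alpha>)"
  then obtain \<alpha> where \<alpha>: "\<alpha> \<in> weights" "Y \<in> root_space H (conj_weight \<alpha>)" by blast
  moreover have "conj_weight \<alpha> \<in> dual_space H" using \<alpha>(1) weights_dual conj_weight_dual by blast
  ultimately show "P Y"
    using assms(3)[of "conj_weight \<alpha>" Y] root_space_subset_sigma_parabolic[of "conj_weight \<alpha>"] by auto
qed

lemma levi_chain_weight_components:
  assumes "Z \<in> levi_chain \<sigma> \<qq> n"
  obtains F f where "finite F" "F \<subseteq> dual_space H" "Z = sum f F"
    "\<And>\<beta>. \<beta> \<in> F \<Longrightarrow> f \<beta> \<in> root_space H \<beta>" "\<And>\<beta>. \<beta> \<in> F \<Longrightarrow> f \<beta> \<in> levi_chain \<sigma> \<qq> n"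
proof -
  have "Z \<in> span (\<Union>\<alpha>\<in>weights. root_space H \<alpha>)"
    using assms levi_chain_iff_iterated parabolic_eq_span by blast
  from weight_components[OF this]
  obtain F f where F: "finite F" "F \<subseteq> weights" "\<forall>\<alpha>\<in>F. f \<alpha> \<in> root_space H \<alpha>" "Z = sum f F"
    by blast
  have dual: "F \<subseteq> dual_space H" using F(2) weights_dual by blast
  have stable: "br h X \<in> levi_chain \<sigma> \<qq> n" if "h \<in> H" "X \<in> levi_chain \<sigma> \<qq> n" for h X
    using levi_chain_ad_stable[OF br_closed_parabolic br_closed_sigma_parabolic _ _
        subspace_parabolic subspace_sigma_parabolic that(2)] cartan_subset that(1) by blast
  have "f \<beta> \<in> levi_chain \<sigma> \<qq> n" if "\<beta> \<in> F" for \<beta>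
  proof (rule weight_component_mem[where H = H])
    show "subspace (levi_chain \<sigma> \<qq> n)"
      by (rule subspace_levi_chain[OF subspace_parabolic subspace_sigma_parabolic])
    show "sum f F \<in> levi_chain \<sigma> \<qq> n" using assms F(4) by blast
  qed (use stable F dual that in blast)+
  then show thesis using that F dual by blast
qed

lemma levi_chain_3_eq_2:
  assumes min: "minimal_type H \<sigma> B \<Phi>"
  shows "levi_chain \<sigma> \<qq> 3 = levi_chain \<sigma> \<qq> 2"
proof
  show "levi_chain \<sigma> \<qq> 3 \<subseteq> levi_chain \<sigma> \<qq> 2" by (rule levi_chain_antimono) simp
  show "levi_chain \<sigma> \<qq> 2 \<subseteq> levi_chain \<sigma> \<qq> 3"
  proof
    fix Z assume Z: "Z \<in> levi_chain \<sigma> \<qq> 2"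
    have triple: "triple Z U V W \<in> \<SS>" if R: "U \<in> \<sigma> ` \<qq>" "V \<in> \<sigma> ` \<qq>" "W \<in> \<sigma> ` \<qq>" for U V W
    proof -
      note sub = subspace_total
      note ind = span_induct_sigma_parabolic
      obtain F f where F: "F \<subseteq> dual_space H" "Z = sum f F" "\<And>\<beta>. \<beta> \<in> F \<Longrightarrow> f \<beta> \<in> root_space H \<beta>"
        "\<And>\<beta>. \<beta> \<in> F \<Longrightarrow> f \<beta> \<in> levi_chain \<sigma> \<qq> 2"
        using levi_chain_weight_components[OF Z] by metis
      have comp: "triple (f \<beta>) U V W \<in> \<SS>" if \<beta>: "\<beta> \<in> F" for \<beta>
        using R(1)
      proof (rule ind)
        show "subspace {U. triple (f \<beta>) U V W \<in> \<SS>}"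
          using sub by (simp add: subspace_def br_add_left br_scale_left br_add_right br_scale_right)
        fix \<alpha> U assume U: "\<alpha> \<in> dual_space H" "U \<in> root_space H \<alpha>" "U \<in> \<sigma> ` \<qq>"
        show "triple (f \<beta>) U V W \<in> \<SS>"
          using R(2)
        proof (rule ind)
          show "subspace {V. triple (f \<beta>) U V W \<in> \<SS>}"
            using sub by (simp add: subspace_def br_add_left br_scale_left br_add_right br_scale_right)
          fix \<gamma> V assume V: "\<gamma> \<in> dual_space H" "V \<in> root_space H \<gamma>" "V \<in> \<sigma> ` \<qq>"
          show "triple (f \<beta>) U V W \<in> \<SS>"
            using R(3)
          proof (rule ind)
            show "subspace {W. triple (f \<beta>) U V W \<in> \<SS>}" by (rule subspace_br_right[OF sub])
            fix \<delta> W assume W: "\<delta> \<in> dual_space H" "W \<in> root_space H \<delta>" "W \<in> \<sigma> ` \<qq>"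
            show "triple (f \<beta>) U V W \<in> \<SS>"
              by (rule triple_weight_vectors[OF min F(4)[OF \<beta>] F(3)[OF \<beta>] U(2,3) V(2,3) W(2,3)
                    subsetD[OF F(1) \<beta>] U(1) V(1) W(1)])
          qed
        qed
      qed
      have "triple (sum f F) U V W = (\<Sum>\<beta>\<in>F. triple (f \<beta>) U V W)"
        by (induction F rule: infinite_finite_induct) (simp_all add: br_add_left)
      then show ?thesis unfolding F(2) using comp subspace_sum[OF sub] by metis
    qed
    have "foldl br Z ws \<in> \<SS>" if ws: "set ws \<subseteq> \<sigma> ` \<qq>" "length ws \<le> 3" for ws
    proof (cases "length ws \<le> 2")
      case True
      then show ?thesis using Z ws(1) unfolding levi_chain_iff_iterated by blast
    next
      case False
      then have "length ws = Suc (Suc (Suc 0))" using ws(2) by simp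
      then obtain U V W where "ws = [U, V, W]" by (auto simp: length_Suc_conv)
      then show ?thesis using triple ws(1) by simp
    qed
    then show "Z \<in> levi_chain \<sigma> \<qq> 3"
      using levi_chain_2D(1)[OF Z] unfolding levi_chain_iff_iterated by blast
  qed
qed

lemma degenerate_or_levi_order_le_2:
  assumes "minimal_type H \<sigma> B \<Phi>"
  shows "holomorphically_degenerate \<sigma> \<qq> \<or> levi_order_le \<sigma> \<qq> 2"
proof (rule disjCI)
  assume "\<not> levi_order_le \<sigma> \<qq> 2"
  then have n2: "levi_chain \<sigma> \<qq> 2 \<noteq> \<qq> \<inter> \<sigma> ` \<qq>" by (simp add: levi_order_le_def)
  have "levi_chain \<sigma> \<qq> p \<noteq> \<qq> \<inter> \<sigma> ` \<qq>" if "p > 0" for p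
  proof (cases "p \<le> 2")
    case True
    then show ?thesis
      using n2 levi_chain_antimono[OF True, of \<sigma> \<qq>]
        Int_subset_levi_chain[OF subspace_parabolic subspace_sigma_parabolic
          br_closed_sigma_parabolic, of 2] by blast
  next
    case False
    have "levi_chain \<sigma> \<qq> (Suc 2) = levi_chain \<sigma> \<qq> 2"
      using levi_chain_3_eq_2[OF assms] by (simp only: eval_nat_numeral)
    then have "levi_chain \<sigma> \<qq> p = levi_chain \<sigma> \<qq> 2"
      by (rule levi_chain_stationary) (use False in simp)
    then show ?thesis using n2 by metis
  qed
  then show "holomorphically_degenerate \<sigma> \<qq>" by (simp add: holomorphically_degenerate_def)
qed

end

theorem theorem2p17:
  fixes scale :: "complex \<Rightarrow> 's::ab_group_add \<Rightarrow> 's"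
    and br :: "'s \<Rightarrow> 's \<Rightarrow> 's"
    and \<sigma> :: "'s \<Rightarrow> 's"
    and H :: "'s set"
    and B \<Phi> :: "('s \<Rightarrow> complex) set"
  defines "\<qq> \<equiv> complex_lie_algebra.parabolic scale br H B \<Phi>"
  assumes "complex_semisimple_lie_algebra scale br"
    and "complex_lie_algebra.antilinear_involution scale br \<sigma>"
    and "complex_lie_algebra.cartan_subalgebra scale br H"
    and "\<sigma> ` H = H"
    and "complex_lie_algebra.simple_basis scale br H B"
    and "\<Phi> \<subseteq> B"
    and "complex_lie_algebra.minimal_type scale br H \<sigma> B \<Phi>"
  shows "complex_lie_algebra.holomorphically_degenerate br \<sigma> \<qq> \<or>
         complex_lie_algebra.levi_order_le br \<sigma> \<qq> 2"
proof -
  interpret complex_semisimple_lie_algebra scale br by fact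
  interpret conjugate_parabolic scale br \<sigma> H B \<Phi>
    by unfold_locales fact+
  show ?thesis
    unfolding \<qq>_def by (rule degenerate_or_levi_order_le_2) fact
qed

end
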